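(* Let $s\ge1$ be an integer, $t\ge 1$, and let $\mathcal{D}_1,\dots,\mathcal{D}_t$ be nonempty data segments with values in a finite totally ordered universe $U$. Put $\alpha = s\big(\sum_{i=1}^{t}|\mathcal{D}_i|^2\big)^{-1/2}$ and $\phi(x)=\cosh(\alpha x)$. If the summaries $S_1,\dots,S_t$ are constructed successively by the procedure CoopQuant with size $s$ and cost function $\phi$, then $$\max_{x\in U}|\varepsilon_t(x)|\le\frac{1+2\ln(2|U|)}{2s}\sqrt{\sum_{i=1}^t|\mathcal{D}_i|^2}.$$
   Context: A data segment $\mathcal{D}$ is a finite multiset of values from a totally ordered set; $f_{\mathcal{D}}(x)$ is the number of occurrences of $x$ in $\mathcal{D}$, $|\mathcal{D}|=\sum_x f_{\mathcal{D}}(x)$, and the rank function is $r_{\mathcal{D}}(x)=\sum_{y\le x}f_{\mathcal{D}}(y)$. A summary $S$ is a finite collection of (value, count) pairs $(x_j,\gamma_j)$; its rank estimate is $r_S(x)=\sum_{j:\,x_j\le x}\gamma_j$. $U$ is a fixed finite totally ordered set containing all values occurring in the segments. For a sequence of segments $\mathcal{D}_1,\mathcal{D}_2,\dots$ with summaries $S_1,S_2,\dots$, the cumulative (prefix) rank error is $\varepsilon_t(x)=\sum_{i=1}^t\big(r_{\mathcal{D}_i}(x)-r_{S_i}(x)\big)$, with $\varepsilon_0\equiv0$. Procedure CoopQuant (size $s$, cost function $\phi$), producing $S_t$ from $\mathcal{D}_t$ and $\varepsilon_{t-1}$: let $h=|\mathcal{D}_t|/s$. Sort the values of $\mathcal{D}_t$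 (with multiplicity) and partition them into $s$ consecutive chunks $\mathcal{D}_{t,1},\dots,\mathcal{D}_{t,s}$, each of total weight exactly $h$, so that every value in $\mathcal{D}_{t,j}$ is $\le$ every value in $\mathcal{D}_{t,j+1}$ (the count of a value may be split between chunks if needed). Initialize $e(x)=\varepsilon_{t-1}(x)+r_{\mathcal{D}_t}(x)$ and $S_t=\emptyset$. For $j=1,\dots,s$ in order: choose $z_j$ among the values in $\mathcal{D}_{t,j}$ minimizing $\sum_{y\in U}\phi\big(e(y)-h\cdot 1_{y\ge z}\big)$ over $z$ (ties broken arbitrarily), add the pair $(z_j,h)$ to $S_t$, and replace $e(x)$ by $e(x)-h\cdot1_{x\ge z_j}$ for all $x$. At the end $e=\varepsilon_t$. *)

theory Defs
  imports Complex_Main "HOL-Library.Multiset"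
begin

definition seg_rank :: "'a::linorder multiset \<Rightarrow> 'a \<Rightarrow> nat" where
  "seg_rank D x = (\<Sum>y\<in>{y \<in> set_mset D. y \<le> x}. count D y)"

definition summary_rank :: "('a::linorder \<times> real) multiset \<Rightarrow> 'a \<Rightarrow> real" where
  "summary_rank S x = (\<Sum>(y, \<gamma>)\<in>#filter_mset (\<lambda>(y, \<gamma>). y \<le> x) S. \<gamma>)"

text \<open>Segments and summaries are indexed from 1; the value at index 0 is irrelevant.\<close>

definition prefix_error ::
  "(nat \<Rightarrow> 'a::linorder multiset) \<Rightarrow> (nat \<Rightarrow> ('a \<times> real) multiset) \<Rightarrow> nat \<Rightarrow> 'a \<Rightarrow> real" where
  "prefix_error D S t x = (\<Sum>i=1..t. real (seg_rank (D i) x) - summary_rank (S i) x)"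

text \<open>
  Since the chunk weight \<open>|D| / s\<close> need not be an integer and the count of a value may be
  split between chunks, the chunk \<open>j \<in> {1..s}\<close> is a nonnegative real weight function \<open>c j\<close>.
  The values occurring in it are those of positive weight.
\<close>

definition is_chunking :: "nat \<Rightarrow> 'a::linorder multiset \<Rightarrow> (nat \<Rightarrow> 'a \<Rightarrow> real) \<Rightarrow> bool" where
  "is_chunking s D c \<longleftrightarrow>
     (\<forall>j\<in>{1..s}. \<forall>x. 0 \<le> c j x) \<and>
     (\<forall>x. (\<Sum>j=1..s. c j x) = real (count D x)) \<and>
     (\<forall>j\<in>{1..s}. (\<Sum>x\<in>set_mset D. c j x) = real (size D) / real s) \<and>
     (\<forall>j\<in>{1..<s}. \<forall>x y. 0 < c j x \<longrightarrow> 0 < c (Suc j) y \<longrightarrow> x \<le> y)"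

text \<open>
  \<open>coopquant_loop U \<phi> h c e\<^sub>0 j e S\<close>: starting from the error function \<open>e\<^sub>0\<close> and the empty
  summary, some run over the chunks \<open>1, \<dots>, j\<close> (ties being broken arbitrarily) ends with
  error function \<open>e\<close> and summary \<open>S\<close>.
\<close>

inductive coopquant_loop ::
  "'a::linorder set \<Rightarrow> (real \<Rightarrow> real) \<Rightarrow> real \<Rightarrow> (nat \<Rightarrow> 'a \<Rightarrow> real) \<Rightarrow> ('a \<Rightarrow> real) \<Rightarrow>
   nat \<Rightarrow> ('a \<Rightarrow> real) \<Rightarrow> ('a \<times> real) multiset \<Rightarrow> bool"
  for U \<phi> h c e\<^sub>0 where
  init: "coopquant_loop U \<phi> h c e\<^sub>0 0 e\<^sub>0 {#}"
| step: "coopquant_loop U \<phi> h c e\<^sub>0 (Suc j) (\<lambda>x. e x - h * of_bool (z \<le> x)) (add_mset (z, h) S)"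
  if "coopquant_loop U \<phi> h c e\<^sub>0 j e S"
    and "is_arg_min (\<lambda>z. \<Sum>y\<in>U. \<phi> (e y - h * of_bool (z \<le> y))) (\<lambda>z. 0 < c (Suc j) z) z"

text \<open>
  \<open>S\<close> is a possible output on the segment \<open>D\<close> with previous prefix error \<open>\<epsilon>\<close>.
\<close>

definition coopquant ::
  "'a::linorder set \<Rightarrow> (real \<Rightarrow> real) \<Rightarrow> nat \<Rightarrow> 'a multiset \<Rightarrow> ('a \<Rightarrow> real) \<Rightarrow>
   ('a \<times> real) multiset \<Rightarrow> bool" where
  "coopquant U \<phi> s D \<epsilon> S \<longleftrightarrow>
     (\<exists>c e. is_chunking s D c \<and>
        coopquant_loop U \<phi> (real (size D) / real s) c (\<lambda>x. \<epsilon> x + real (seg_rank D x)) s e S)"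

end

theory Submission
  imports Defs "HOL-Probability.Hoeffding"
begin

text \<open>
  Use the potential \<open>\<Sum>y\<in>U. cosh (\<alpha> * \<epsilon> y)\<close>. A chunk of total weight \<open>h\<close> and rank function \<open>r\<close>
  changes the error only at the points \<open>y\<close> with \<open>0 < r y < h\<close>. If \<open>z\<close> were drawn from the
  chunk with probability proportional to weight, the error at such a \<open>y\<close> would change by a centred
  random variable with range \<open>h\<close>, so by Hoeffding's lemma the expected potential there would grow
  by at most the factor \<open>exp ((\<alpha> * h)\<^sup>2 / 8)\<close>; the greedy choice does no worse. Each \<open>y\<close> is
  interior to at most one chunk of a segment, so this factor is paid only once per segment, not once
  per chunk.
\<close>

section \<open>Moment bounds for centred two-point variables\<close>

text \<open>This is Hoeffding's lemma for the centred variable with value \<open>1 - p\<close> of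
  probability \<open>p\<close> and \<open>- p\<close> of probability \<open>1 - p\<close>, whose
  range has length 1.\<close>

lemma exp_two_point_le:
  fixes p x :: real
  assumes "0 \<le> p" "p \<le> 1"
  shows "p * exp ((1 - p) * x) + (1 - p) * exp (- p * x) \<le> exp (x\<^sup>2 / 8)"
proof -
  have *: "p * exp ((1 - p) * x) + (1 - p) * exp (- p * x) \<le> exp (x\<^sup>2 / 8)"
    if "0 \<le> p" "p \<le> 1" "0 \<le> x" for p x :: real
  proof -
    have pos: "0 < 1 + p * (exp x - 1)"
      using that by (simp add: add_pos_nonneg)
    \<comment> \<open>Factoring out \<open>exp (- x * p)\<close> brings the moment generating
      function into the logarithmic form bounded by \<open>Hoeffdings_lemma_aux\<close>.\<close>
    have "p * exp ((1 - p) * x) + (1 - p) * exp (- p * x) = exp (- x * p) * (1 + p * (exp x - 1))"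
      by (simp add: algebra_simps flip: exp_add)
    also have "\<dots> = exp (- x * p + ln (1 + p * (exp x - 1)))"
      using pos by (simp only: exp_add exp_ln)
    also have "\<dots> \<le> exp (x\<^sup>2 / 8)"
      using Hoeffdings_lemma_aux[of x p] that by simp
    finally show ?thesis .
  qed
  show ?thesis
  proof (cases "0 \<le> x")
    case True
    then show ?thesis using * assms by simp
  next
    case False
    \<comment> \<open>Reflecting the variable swaps the two probabilities and the sign of
      \<open>x\<close>.\<close>
    then show ?thesis using *[of "1 - p" "- x"] assms by (simp add: algebra_simps)
  qed
qed

text \<open>Subtracting \<open>h\<close> from \<open>e\<close> with probability
  \<open>r / h\<close>, and nothing otherwise, has mean \<open>e - r\<close>. Hoeffding bounds the
  exponentials with rates \<open>a\<close> and \<open>- a\<close>, and cosh is their average;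
  everything is multiplied by \<open>h\<close> to avoid division.\<close>

lemma cosh_two_point_le:
  fixes a e r h :: real
  assumes "0 \<le> r" "r \<le> h" "0 < h"
  shows "r * cosh (a * (e - h)) + (h - r) * cosh (a * e)
    \<le> h * exp ((a * h)\<^sup>2 / 8) * cosh (a * (e - r))"
proof -
  have *: "r * exp (b * (e - h)) + (h - r) * exp (b * e) \<le> h * exp ((b * h)\<^sup>2 / 8) * exp (b * (e - r))"
    for b
  proof -
    define p where "p = r / h"
    have r: "r = h * p" and p: "0 \<le> p" "p \<le> 1"
      using assms by (simp_all add: p_def)
    have "r * exp (b * (e - h)) + (h - r) * exp (b * e)
      = h * exp (b * (e - r)) * (p * exp ((1 - p) * (- b * h)) + (1 - p) * exp (- p * (- b * h)))"
      by (simp add: r algebra_simps flip: exp_add)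
    also have "\<dots> \<le> h * exp (b * (e - r)) * exp ((- b * h)\<^sup>2 / 8)"
      using assms by (intro mult_left_mono exp_two_point_le p) auto
    finally show ?thesis by (simp add: mult_ac)
  qed
  show ?thesis
    using *[of a] *[of "- a"] by (simp add: cosh_field_def algebra_simps add_divide_distrib[symmetric])
qed

section \<open>Rank of a single chunk and the greedy choice in it\<close>

definition chunk_rank :: "'a::linorder set \<Rightarrow> ('a \<Rightarrow> real) \<Rightarrow> 'a \<Rightarrow> real" where
  "chunk_rank V c y = (\<Sum>x\<in>V. c x * of_bool (x \<le> y))"

locale chunk =
  fixes V :: "'a::linorder set" and c :: "'a \<Rightarrow> real" and h :: real
  assumes finite_V: "finite V"
    and nonneg: "0 \<le> c x"
    and outside: "x \<notin> V \<Longrightarrow> c x = 0"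
    and total: "sum c V = h"
    and h_pos: "0 < h"
begin

lemma in_V: "0 < c x \<Longrightarrow> x \<in> V"
  using outside[of x] by auto

lemma ex_pos: "\<exists>x. 0 < c x"
proof (rule ccontr)
  assume "\<not> ?thesis"
  then have "sum c V \<le> 0" by (intro sum_nonpos) (auto simp: not_less)
  then show False using total h_pos by simp
qed

lemma rank_nonneg: "0 \<le> chunk_rank V c y"
  unfolding chunk_rank_def using nonneg by (intro sum_nonneg) auto

lemma rank_le: "chunk_rank V c y \<le> h"
  unfolding chunk_rank_def total[symmetric] using nonneg by (intro sum_mono) auto

lemma rank_pos:
  assumes "0 < c z" "z \<le> y" shows "0 < chunk_rank V c y"
  unfolding chunk_rank_def
  by (rule sum_pos2[OF finite_V in_V[OF assms(1)]]) (use assms nonneg in auto)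

lemma rank_less:
  assumes "0 < c z" "\<not> z \<le> y" shows "chunk_rank V c y < h"
  unfolding chunk_rank_def total[symmetric]
  by (rule sum_strict_mono_ex1[OF finite_V]) (use assms nonneg in_V in \<open>auto intro!: bexI[of _ z]\<close>)

lemma rank_posE:
  assumes "0 < chunk_rank V c y" obtains z where "0 < c z" "z \<le> y"
proof -
  have "\<exists>z\<in>V. 0 < c z * of_bool (z \<le> y)"
    using assms unfolding chunk_rank_def by (meson not_less sum_nonpos)
  then show ?thesis using that by (auto simp: zero_less_mult_iff of_bool_def split: if_splits)
qed

lemma rank_eq_top:
  assumes "\<And>x. 0 < c x \<Longrightarrow> x \<le> y" shows "chunk_rank V c y = h"
  unfolding chunk_rank_def total[symmetric]
  using assms nonneg by (intro sum.cong) (auto simp: less_le)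

text \<open>At a point of chunk rank 0 or \<open>h\<close>, all chunk values lie on one side, so
  every candidate changes the error there by exactly the chunk's rank.\<close>

lemma rank_exterior:
  assumes "0 < c z" "\<not> (0 < chunk_rank V c y \<and> chunk_rank V c y < h)"
  shows "h * of_bool (z \<le> y) = chunk_rank V c y"
  using assms rank_pos[of z y] rank_less[of z y] rank_le[of y] rank_nonneg[of y]
  by (cases "z \<le> y") auto

text \<open>The minimum over candidates is at most their average weighted by \<open>c\<close>.
  Averaging turns the update at each point into the two-point variable of
  \<open>cosh_two_point_le\<close>.\<close>

lemma greedy_choice:
  fixes a :: real and e :: "'a \<Rightarrow> real"
  assumes "finite U"
    and z: "is_arg_min (\<lambda>z. \<Sum>y\<in>U. cosh (a * (e y - h * of_bool (z \<le> y)))) (\<lambda>z. 0 < c z) z"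
  defines "A \<equiv> {y \<in> U. 0 < chunk_rank V c y \<and> chunk_rank V c y < h}"
  shows "(\<Sum>y\<in>A. cosh (a * (e y - h * of_bool (z \<le> y))))
    \<le> exp ((a * h)\<^sup>2 / 8) * (\<Sum>y\<in>A. cosh (a * (e y - chunk_rank V c y)))"
proof -
  let ?F = "\<lambda>B z. \<Sum>y\<in>B. cosh (a * (e y - h * of_bool (z \<le> y)))"
  have A: "A \<subseteq> U" by (auto simp: A_def)
  have cz: "0 < c z" and min: "?F U z \<le> ?F U x" if "0 < c x" for x
    using z that by (auto simp: is_arg_min_linorder)
  have "?F A z \<le> ?F A x" if x: "0 < c x" for x
  proof -
    \<comment> \<open>Outside \<open>A\<close> the cost does not depend on the candidate, so a
      minimiser over \<open>U\<close> is also one over \<open>A\<close>.\<close>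
    have "?F (U - A) z = ?F (U - A) x"
      using rank_exterior[OF x] rank_exterior[OF cz[OF x]]
      by (intro sum.cong refl) (auto simp: A_def)
    then show ?thesis
      using min[OF x] unfolding sum.subset_diff[OF A \<open>finite U\<close>] by simp
  qed
  \<comment> \<open>Values of weight 0 are no candidates, but then both sides vanish.\<close>
  then have "c x * ?F A z \<le> c x * ?F A x" for x
    using nonneg[of x] by (cases "c x = 0") (auto simp: less_le)
  then have "h * ?F A z \<le> (\<Sum>x\<in>V. c x * ?F A x)"
    unfolding total[symmetric] sum_distrib_right by (intro sum_mono)
  also have "(\<Sum>x\<in>V. c x * ?F A x)
      = (\<Sum>y\<in>A. \<Sum>x\<in>V. c x * cosh (a * (e y - h * of_bool (x \<le> y))))"
    by (subst sum.swap) (simp add: sum_distrib_left)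
  also have "\<dots> = (\<Sum>y\<in>A. chunk_rank V c y * cosh (a * (e y - h))
      + (h - chunk_rank V c y) * cosh (a * e y))"
  proof (intro sum.cong refl)
    fix y
    have "(\<Sum>x\<in>V. c x * cosh (a * (e y - h * of_bool (x \<le> y))))
      = (\<Sum>x\<in>V. (c x * of_bool (x \<le> y)) * cosh (a * (e y - h))
          + (c x - c x * of_bool (x \<le> y)) * cosh (a * e y))"
      by (intro sum.cong) auto
    also have "\<dots> = chunk_rank V c y * cosh (a * (e y - h))
      + (h - chunk_rank V c y) * cosh (a * e y)"
      by (simp add: chunk_rank_def total[symmetric] sum.distrib sum_subtractf flip: sum_distrib_right)
    finally show "(\<Sum>x\<in>V. c x * cosh (a * (e y - h * of_bool (x \<le> y)))) = \<dots>" .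
  qed
  also have "\<dots> \<le> (\<Sum>y\<in>A. h * exp ((a * h)\<^sup>2 / 8) * cosh (a * (e y - chunk_rank V c y)))"
    by (intro sum_mono cosh_two_point_le rank_nonneg rank_le h_pos)
  finally have "h * ?F A z \<le> h * (exp ((a * h)\<^sup>2 / 8) * (\<Sum>y\<in>A. cosh (a * (e y - chunk_rank V c y))))"
    by (simp add: sum_distrib_left mult.assoc)
  then show ?thesis using h_pos by simp
qed

end

section \<open>Potential argument within one segment\<close>

locale chunking =
  fixes s :: nat and D :: "'a::linorder multiset" and c :: "nat \<Rightarrow> 'a \<Rightarrow> real" and h :: real
  assumes s_pos: "s \<ge> 1" and D_nonempty: "D \<noteq> {#}"
    and is_chunking: "is_chunking s D c"
    and h_def: "h = real (size D) / real s"
begin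

abbreviation R :: "nat \<Rightarrow> 'a \<Rightarrow> real" where
  "R j \<equiv> chunk_rank (set_mset D) (c j)"

definition remaining :: "nat \<Rightarrow> 'a \<Rightarrow> real" where
  "remaining k y = (\<Sum>j\<in>{k<..s}. R j y)"

definition interior :: "nat \<Rightarrow> 'a \<Rightarrow> bool" where
  "interior k y \<longleftrightarrow> (\<exists>j\<in>{k<..s}. 0 < R j y \<and> R j y < h)"

text \<open>
  Points still to be met in the interior of a chunk are charged the Hoeffding factor in advance, and
  the chunks not yet summarised are left out of the error.
\<close>

definition potential :: "real \<Rightarrow> 'a set \<Rightarrow> nat \<Rightarrow> ('a \<Rightarrow> real) \<Rightarrow> real" where
  "potential a U k e =
    (\<Sum>y\<in>U. (if interior k y then exp ((a * h)\<^sup>2 / 8) else 1) * cosh (a * (e y - remaining k y)))"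

lemma chunk: "chunk (set_mset D) (c j) h" if "j \<in> {1..s}"
proof
  show nonneg: "0 \<le> c j x" for x
    using is_chunking that by (auto simp: is_chunking_def)
  show "c j x = 0" if "x \<notin># D" for x
  proof -
    have "(\<Sum>j=1..s. c j x) = 0"
      using is_chunking that by (simp add: is_chunking_def not_in_iff)
    then show ?thesis
      using is_chunking \<open>j \<in> {1..s}\<close> by (subst (asm) sum_nonneg_eq_0_iff) (auto simp: is_chunking_def)
  qed
  show "sum (c j) (set_mset D) = h"
    using is_chunking that by (auto simp: is_chunking_def h_def)
  show "0 < h"
    using s_pos D_nonempty by (simp add: h_def nonempty_has_size)
qed simp

text \<open>Only adjacent chunks are ordered by definition. Transitivity needs a value in every
  chunk in between, which exists because \<open>h\<close> is positive.\<close>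

lemma chunks_ordered:
  assumes "1 \<le> i" "i < j" "j \<le> s" "0 < c i x" "0 < c j y"
  shows "x \<le> y"
proof -
  have adjacent: "x \<le> y" if "1 \<le> j" "j < s" "0 < c j x" "0 < c (Suc j) y" for j x y
    using is_chunking that by (auto simp: is_chunking_def)
  from \<open>i < j\<close> have "Suc i \<le> j" by simp
  then show ?thesis using \<open>j \<le> s\<close> \<open>0 < c j y\<close>
  proof (induction j arbitrary: y rule: dec_induct)
    case base
    then show ?case using adjacent[of i x y] assms by simp
  next
    case (step n)
    obtain w where "0 < c n w"
      using chunk.ex_pos[OF chunk, of n] step by auto
    then show ?case
      using step adjacent[of n w y] by fastforce
  qed
qed

text \<open>If a later chunk had a value at or below \<open>y\<close>, all of chunk \<open>i\<close>
  would lie at or below \<open>y\<close> and have rank \<open>h\<close> there. Hence a point is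
  interior to at most one chunk.\<close>

lemma later_rank_eq_0:
  assumes "1 \<le> i" "i < j" "j \<le> s" "R i y < h"
  shows "R j y = 0"
proof (rule ccontr)
  interpret i: chunk "set_mset D" "c i" h using chunk assms by simp
  interpret j: chunk "set_mset D" "c j" h using chunk assms by simp
  assume "R j y \<noteq> 0"
  then obtain x where "0 < c j x" "x \<le> y"
    using j.rank_nonneg[of y] by (metis j.rank_posE less_le)
  then have "R i y = h"
    using chunks_ordered[OF assms(1-3)] by (intro i.rank_eq_top) fastforce
  then show False using assms by simp
qed

lemma seg_rank_eq: "real (seg_rank D y) = remaining 0 y"
proof -
  have "real (seg_rank D y) = (\<Sum>x\<in>set_mset D. real (count D x) * of_bool (x \<le> y))"
    by (simp add: seg_rank_def of_bool_def sum.If_cases if_distrib sum.inter_filter cong: if_cong)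
  also have "\<dots> = (\<Sum>x\<in>set_mset D. \<Sum>j=1..s. c j x * of_bool (x \<le> y))"
    using is_chunking by (simp add: is_chunking_def flip: sum_distrib_right)
  also have "\<dots> = remaining 0 y"
    unfolding remaining_def chunk_rank_def
    by (subst sum.swap) (simp add: atLeastSucAtMost_greaterThanAtMost)
  finally show ?thesis .
qed

text \<open>Exterior points keep their contribution. Interior points lose their advance factor,
  which pays for the growth allowed by \<open>greedy_choice\<close>.\<close>

lemma potential_step:
  assumes "finite U" "k < s"
    and z: "is_arg_min (\<lambda>z. \<Sum>y\<in>U. cosh (a * (e y - h * of_bool (z \<le> y)))) (\<lambda>z. 0 < c (Suc k) z) z"
  shows "potential a U (Suc k) (\<lambda>y. e y - h * of_bool (z \<le> y)) \<le> potential a U k e"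
proof -
  interpret chunk "set_mset D" "c (Suc k)" h using chunk assms by simp
  define A where "A = {y \<in> U. 0 < R (Suc k) y \<and> R (Suc k) y < h}"
  let ?K = "exp ((a * h)\<^sup>2 / 8)"
  let ?f = "\<lambda>k e y. (if interior k y then ?K else 1) * cosh (a * (e y - remaining k y))"
  let ?e = "\<lambda>y. e y - h * of_bool (z \<le> y)"
  have A: "A \<subseteq> U" by (auto simp: A_def)
  have split: "{k<..s} = insert (Suc k) {Suc k<..s}" using \<open>k < s\<close> by auto
  have remaining: "remaining k y = R (Suc k) y + remaining (Suc k) y" for y
    by (simp add: remaining_def split)
  have cz: "0 < c (Suc k) z" using z by (auto simp: is_arg_min_def)
  have "(\<Sum>y\<in>U - A. ?f (Suc k) ?e y) = (\<Sum>y\<in>U - A. ?f k e y)"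
  proof (intro sum.cong refl)
    fix y assume "y \<in> U - A"
    then have ext: "\<not> (0 < R (Suc k) y \<and> R (Suc k) y < h)" by (auto simp: A_def)
    \<comment> \<open>Chunk \<open>Suc k\<close> is the only one dropped from the range, and
      \<open>y\<close> is not interior to it.\<close>
    then have "interior (Suc k) y = interior k y" by (auto simp: interior_def split)
    then show "?f (Suc k) ?e y = ?f k e y"
      using rank_exterior[OF cz ext] remaining[of y] by (simp add: algebra_simps)
  qed
  moreover have "(\<Sum>y\<in>A. ?f (Suc k) ?e y) \<le> (\<Sum>y\<in>A. ?f k e y)"
  proof -
    have later: "R j y = 0" if "y \<in> A" "j \<in> {Suc k<..s}" for j y
      using later_rank_eq_0[of "Suc k" j y] that by (auto simp: A_def)
    \<comment> \<open>The greedy rule sees \<open>e\<close>, which still includes the later chunks;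
      on \<open>A\<close> these contribute nothing, so its cost agrees with the potential
      there.\<close>
    then have zero: "remaining (Suc k) y = 0" "\<not> interior (Suc k) y" if "y \<in> A" for y
      using that by (auto simp: remaining_def interior_def)
    have int: "interior k y" if "y \<in> A" for y
      using that by (auto simp: interior_def split A_def)
    have "(\<Sum>y\<in>A. ?f (Suc k) ?e y) = (\<Sum>y\<in>A. cosh (a * ?e y))"
      using zero by (intro sum.cong) auto
    also have "\<dots> \<le> ?K * (\<Sum>y\<in>A. cosh (a * (e y - R (Suc k) y)))"
      unfolding A_def using greedy_choice[OF \<open>finite U\<close> z] .
    also have "\<dots> = (\<Sum>y\<in>A. ?f k e y)"
      unfolding sum_distrib_left using zero int remaining by (intro sum.cong) auto
    finally show ?thesis .
  qed
  ultimately show ?thesis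
    unfolding potential_def sum.subset_diff[OF A \<open>finite U\<close>] by simp
qed

lemma potential_loop:
  assumes "coopquant_loop U (\<lambda>x. cosh (a * x)) h c e\<^sub>0 k e S" "finite U" "k \<le> s"
  shows "potential a U k e \<le> potential a U 0 e\<^sub>0"
  using assms
proof (induction rule: coopquant_loop.induct)
  case init
  then show ?case by simp
next
  case (step k e S z)
  then have "potential a U (Suc k) (\<lambda>y. e y - h * of_bool (z \<le> y)) \<le> potential a U k e"
    by (intro potential_step) auto
  also have "\<dots> \<le> potential a U 0 e\<^sub>0"
    using step by simp
  finally show ?case .
qed

text \<open>At \<open>k = s\<close> nothing remains and no factor is charged. At
  \<open>k = 0\<close> the remaining rank cancels the rank of the segment, leaving \<epsilon> with
  at most one factor per point.\<close>

lemma segment_bound: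
  assumes "coopquant_loop U (\<lambda>x. cosh (a * x)) h c (\<lambda>x. \<epsilon> x + real (seg_rank D x)) s e S" "finite U"
  shows "(\<Sum>y\<in>U. cosh (a * e y)) \<le> exp ((a * h)\<^sup>2 / 8) * (\<Sum>y\<in>U. cosh (a * \<epsilon> y))"
proof -
  have "(\<Sum>y\<in>U. cosh (a * e y)) = potential a U s e"
    by (simp add: potential_def interior_def remaining_def)
  also have "\<dots> \<le> potential a U 0 (\<lambda>x. \<epsilon> x + real (seg_rank D x))"
    using assms by (intro potential_loop) auto
  also have "\<dots> \<le> (\<Sum>y\<in>U. exp ((a * h)\<^sup>2 / 8) * cosh (a * \<epsilon> y))"
    unfolding potential_def seg_rank_eq by (intro sum_mono mult_mono) auto
  finally show ?thesis by (simp add: sum_distrib_left)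
qed

end

section \<open>From one segment to the prefix error\<close>

lemma coopquant_loop_error:
  assumes "coopquant_loop U \<phi> h c e\<^sub>0 k e S"
  shows "e x = e\<^sub>0 x - summary_rank S x"
  using assms by induction (simp_all add: summary_rank_def)

lemma coopquant_potential:
  assumes "s \<ge> 1" "D \<noteq> {#}" "finite U" and run: "coopquant U (\<lambda>x. cosh (a * x)) s D \<epsilon> S"
  shows "(\<Sum>y\<in>U. cosh (a * (\<epsilon> y + (real (seg_rank D y) - summary_rank S y))))
    \<le> exp ((a * (real (size D) / real s))\<^sup>2 / 8) * (\<Sum>y\<in>U. cosh (a * \<epsilon> y))"
proof -
  obtain c e where c: "is_chunking s D c"
    and loop: "coopquant_loop U (\<lambda>x. cosh (a * x)) (real (size D) / real s) c
      (\<lambda>x. \<epsilon> x + real (seg_rank D x)) s e S"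
    using run by (auto simp: coopquant_def)
  interpret chunking s D c "real (size D) / real s"
    by standard (use assms c in auto)
  have "e y = \<epsilon> y + (real (seg_rank D y) - summary_rank S y)" for y
    using coopquant_loop_error[OF loop, of y] by simp
  then show ?thesis using segment_bound[OF loop \<open>finite U\<close>] by simp
qed

text \<open>The segment factors multiply, so their exponents add up to a sum of squared sizes. The
  initial error 0 gives potential \<open>card U\<close>, as cosh 0 is 1.\<close>

lemma prefix_error_potential:
  assumes "s \<ge> 1" "finite U"
    and "\<forall>i\<in>{1..t}. D i \<noteq> {#}"
    and "\<forall>i\<in>{1..t}. coopquant U (\<lambda>x. cosh (a * x)) s (D i) (prefix_error D S (i - 1)) (S i)"
  shows "(\<Sum>y\<in>U. cosh (a * prefix_error D S t y))
    \<le> exp (a\<^sup>2 * (\<Sum>i=1..t. (real (size (D i)))\<^sup>2) / (8 * (real s)\<^sup>2)) * real (card U)"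
  using assms(3,4)
proof (induction t)
  case 0
  then show ?case by (simp add: prefix_error_def)
next
  case (Suc t)
  let ?Q = "\<lambda>t. \<Sum>i=1..t. (real (size (D i)))\<^sup>2"
  let ?K = "exp ((a * (real (size (D (Suc t))) / real s))\<^sup>2 / 8)"
  have "(\<Sum>y\<in>U. cosh (a * prefix_error D S (Suc t) y))
      = (\<Sum>y\<in>U. cosh (a * (prefix_error D S t y
          + (real (seg_rank (D (Suc t)) y) - summary_rank (S (Suc t)) y))))"
    by (simp add: prefix_error_def)
  also have "\<dots> \<le> ?K * (\<Sum>y\<in>U. cosh (a * prefix_error D S t y))"
    using Suc.prems by (intro coopquant_potential assms) (force dest: bspec[of _ _ "Suc t"])+
  also have "\<dots> \<le> ?K * (exp (a\<^sup>2 * ?Q t / (8 * (real s)\<^sup>2)) * real (card U))"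
    using Suc by (intro mult_left_mono) auto
  also have "\<dots> = exp (a\<^sup>2 * ?Q (Suc t) / (8 * (real s)\<^sup>2)) * real (card U)"
    by (simp add: power_mult_distrib power_divide algebra_simps add_divide_distrib flip: exp_add)
  finally show ?case .
qed

theorem theorem2:
  fixes U :: "'a::linorder set"
    and D :: "nat \<Rightarrow> 'a multiset"
    and S :: "nat \<Rightarrow> ('a \<times> real) multiset"
    and s t :: nat
    and \<alpha> :: real
    and \<phi> :: "real \<Rightarrow> real"
  assumes "s \<ge> 1" and "t \<ge> 1"
    and "finite U"
    and "\<forall>i\<in>{1..t}. D i \<noteq> {#} \<and> set_mset (D i) \<subseteq> U"
    and "\<alpha> = real s * (\<Sum>i=1..t. (real (size (D i)))\<^sup>2) powr (- 1 / 2)"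
    and "\<phi> = (\<lambda>x. cosh (\<alpha> * x))"
    and "\<forall>i\<in>{1..t}. coopquant U \<phi> s (D i) (prefix_error D S (i - 1)) (S i)"
  shows "(MAX x\<in>U. \<bar>prefix_error D S t x\<bar>)
    \<le> (1 + 2 * ln (2 * real (card U))) / (2 * real s) * sqrt (\<Sum>i=1..t. (real (size (D i)))\<^sup>2)"
proof -
  define Q where "Q = (\<Sum>i=1..t. (real (size (D i)))\<^sup>2)"
  have "D 1 \<noteq> {#}" "set_mset (D 1) \<subseteq> U"
    using assms(2,4) by auto
  then have "U \<noteq> {}" by auto
  then have card: "0 < real (card U)"
    using \<open>finite U\<close> by (simp add: card_gt_0_iff)
  have Q: "0 < Q"
    unfolding Q_def
    by (rule sum_pos2[of _ 1]) (use \<open>t \<ge> 1\<close> \<open>D 1 \<noteq> {#}\<close> in \<open>auto simp: nonempty_has_size\<close>)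
  have \<alpha>: "\<alpha> = real s / sqrt Q"
    using Q by (simp only: assms(5) flip: Q_def) (simp add: powr_minus_divide powr_half_sqrt)
  have \<alpha>_pos: "0 < \<alpha>" using \<alpha> Q assms(1) by simp
  \<comment> \<open>The choice of \<alpha> normalises the accumulated exponent to a
    constant.\<close>
  have exponent: "\<alpha>\<^sup>2 * Q / (8 * (real s)\<^sup>2) = 1 / 8"
    using Q assms(1) by (simp add: \<alpha> power_divide)
  have bound: "\<bar>prefix_error D S t x\<bar> \<le> (1 + 2 * ln (2 * real (card U))) / (2 * real s) * sqrt Q"
    if "x \<in> U" for x
  proof -
    let ?e = "prefix_error D S t"
    \<comment> \<open>A single cosh controls both signs of the error at the cost of a factor 2, the
      one inside the final logarithm.\<close>
    have "exp \<bar>\<alpha> * ?e x\<bar> \<le> 2 * cosh (\<alpha> * ?e x)"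
      by (cases "0 \<le> \<alpha> * ?e x") (simp_all add: cosh_field_def)
    also have "cosh (\<alpha> * ?e x) \<le> (\<Sum>y\<in>U. cosh (\<alpha> * ?e y))"
      using \<open>finite U\<close> that by (intro member_le_sum) auto
    also have "\<dots> \<le> exp (1 / 8) * real (card U)"
      using prefix_error_potential[of s U t D \<alpha> S] assms(1,3,4,7)
      unfolding assms(6) Q_def[symmetric] exponent by simp
    finally have "exp \<bar>\<alpha> * ?e x\<bar> \<le> exp (1 / 8) * (2 * real (card U))"
      by simp
    then have "\<bar>\<alpha> * ?e x\<bar> \<le> 1 / 8 + ln (2 * real (card U))"
      using card by (simp add: ln_mult flip: ln_ge_iff)
    \<comment> \<open>Relaxing 1/8 to 1/2 gives the constant of the claim.\<close>
    then have "\<alpha> * \<bar>?e x\<bar> \<le> 1 / 2 + ln (2 * real (card U))"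
      using \<alpha>_pos by (simp add: abs_mult)
    then have "\<bar>?e x\<bar> \<le> (1 / 2 + ln (2 * real (card U))) / \<alpha>"
      using \<alpha>_pos by (simp add: pos_le_divide_eq mult.commute)
    also have "\<dots> = (1 + 2 * ln (2 * real (card U))) / (2 * real s) * sqrt Q"
      using assms(1) Q by (simp add: \<alpha> field_simps)
    finally show ?thesis .
  qed
  then show ?thesis
    using \<open>finite U\<close> \<open>U \<noteq> {}\<close> by (simp add: Q_def)
qed

end
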